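(* Let $G$ be a dense subgroup of a Hausdorff topological group $H$. If $G$ is a Lindelöf $\Sigma$-space, then $w(H)=w(G)\leq\psi(G)^\omega$.
   Context: $w$ weight, $\psi$ pseudocharacter. The Nagami number $Nag(Y)$ of a Tychonoff space $Y$ is the minimal cardinality of a family $\mathcal F$ of closed subsets of $\beta Y$ such that for every $y\in Y$ and $z\in\beta Y\setminus Y$ there is $F\in\mathcal F$ with $y\in F$, $z\notin F$; $Y$ is a Lindelöf $\Sigma$-space if $Nag(Y)\leq\omega$. *)

theory Defs
  imports "HOL-Analysis.Analysis" "HOL-Algebra.Group"
begin

definition topological_group :: "('a, 'b) monoid_scheme \<Rightarrow> 'a topology \<Rightarrow> bool" where
  "topological_group H T \<longleftrightarrow> group H \<and> topspace T = carrier H \<and>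
     continuous_map (prod_topology T T) T (\<lambda>(x, y). x \<otimes>\<^bsub>H\<^esub> y) \<and>
     continuous_map T T (\<lambda>x. inv\<^bsub>H\<^esub> x)"

definition is_base :: "'a topology \<Rightarrow> 'a set set \<Rightarrow> bool" where
  "is_base X B \<longleftrightarrow> (\<forall>U\<in>B. openin X U) \<and>
     (\<forall>U. openin X U \<longrightarrow> (\<forall>x\<in>U. \<exists>V\<in>B. x \<in> V \<and> V \<subseteq> U))"

text \<open>min base cardinality of X is at most the cardinality of A
  (for infinite A this is w(X) \<le> |A| with the convention w(X) \<ge> \<omega>).\<close>
definition weight_le :: "'a topology \<Rightarrow> 'c set \<Rightarrow> bool" where
  "weight_le X A \<longleftrightarrow> (\<exists>B. is_base X B \<and> (card_of B, card_of A) \<in> ordLeq)"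

text \<open>every point of X is the intersection of a family of at most |A| open sets
  (for infinite A this is \<psi>(X) \<le> |A| with the convention \<psi>(X) \<ge> \<omega>).\<close>
definition pseudochar_le :: "'a topology \<Rightarrow> 'c set \<Rightarrow> bool" where
  "pseudochar_le X A \<longleftrightarrow> (\<forall>x\<in>topspace X. \<exists>\<U>. (\<forall>U\<in>\<U>. openin X U \<and> x \<in> U) \<and>
      topspace X \<inter> \<Inter>\<U> = {x} \<and> (card_of \<U>, card_of A) \<in> ordLeq)"

text \<open>(K, e) is a Stone-Cech compactification of Y: K compact Hausdorff, e a
  dense embedding, and every continuous map Y \<rightarrow> [0,1] extends over K.
  This characterizes \<beta>Y up to a homeomorphism fixing Y.\<close>
definition stone_cech :: "'a topology \<Rightarrow> 'k topology \<Rightarrow> ('a \<Rightarrow> 'k) \<Rightarrow> bool" where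
  "stone_cech Y K e \<longleftrightarrow> compact_space K \<and> Hausdorff_space K \<and> embedding_map Y K e \<and>
     K closure_of (e ` topspace Y) = topspace K \<and>
     (\<forall>f. continuous_map Y (top_of_set {0..1::real}) f \<longrightarrow>
        (\<exists>g. continuous_map K (top_of_set {0..1::real}) g \<and> (\<forall>y\<in>topspace Y. g (e y) = f y)))"

text \<open>Lindelof Sigma-space: Nag(Y) \<le> \<omega>, i.e. a countable family of closed subsets of
  \<beta>Y separating points of Y from points of \<beta>Y \<setminus> Y. \<beta>Y is represented on the type
  'a set set (it has a copy there, e.g. as z-ultrafilters).\<close>
definition lindelof_sigma :: "'a topology \<Rightarrow> bool" where
  "lindelof_sigma Y \<longleftrightarrow> (\<exists>(K :: 'a set set topology) e. stone_cech Y K e \<and>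
     (\<exists>\<F>. countable \<F> \<and> (\<forall>F\<in>\<F>. closedin K F) \<and>
        (\<forall>y\<in>topspace Y. \<forall>z\<in>topspace K - e ` topspace Y. \<exists>F\<in>\<F>. e y \<in> F \<and> z \<notin> F)))"

end

theory Submission
  imports Defs "HOL-Library.Countable_Set_Type"
begin

text \<open>
  If \<open>G\<close> is dense in \<open>H\<close>, the interiors of the closures of basic neighbourhoods of the identity in \<open>G\<close>
  form a local base of \<open>H\<close> by regularity, and translating them by a dense set of at most \<open>w(G)\<close> points
  of \<open>G\<close> gives a base of \<open>H\<close>.

  For the bound on \<open>w(G)\<close>, a Lindelof Sigma-space has a countable family \<open>\<N>\<close> and a cover by compact sets
  such that every neighbourhood of a member \<open>C\<close> of the cover contains, for each point of \<open>C\<close>, an element of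
  \<open>\<N>\<close> through that point. The Lindelof property turns a pseudobase at the identity into \<open>\<psi>(G)\<close> many pairs of
  disjoint open sets separating points, hence, after finite unions and intersections, disjoint compact sets.
  For closed \<open>F\<close> contained in an open \<open>U\<close>, applying this to \<open>C \<inter> F\<close> and \<open>C - U\<close> yields a countable union of
  sets \<open>N \<inter> W\<close> (\<open>N \<in> \<N>\<close>, \<open>W\<close> from the pairs) lying between \<open>F\<close> and \<open>U\<close>. There are \<open>\<psi>(G)\<^sup>\<omega>\<close> such unions,
  and their interiors form a base.
\<close>

unbundle cardinal_syntax

section \<open>Translates and regularity in topological groups\<close>

text \<open>The set is the left translate of \<open>V\<close> by \<open>d\<close>. Written as the
  preimage of \<open>V\<close> under left multiplication by \<open>inv d\<close>, it is open by
  continuity of multiplication.\<close>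

lemma openin_translate:
  assumes "topological_group H T" "openin T V" "d \<in> carrier H"
  shows "openin T {z \<in> carrier H. inv\<^bsub>H\<^esub> d \<otimes>\<^bsub>H\<^esub> z \<in> V}"
proof -
  have m: "continuous_map (prod_topology T T) T (\<lambda>(x, y). x \<otimes>\<^bsub>H\<^esub> y)" and "group H"
    and ts: "topspace T = carrier H"
    using assms(1) by (auto simp: topological_group_def)
  then have "inv\<^bsub>H\<^esub> d \<in> topspace T"
    using assms(3) by simp
  then have "continuous_map T T (\<lambda>z. inv\<^bsub>H\<^esub> d \<otimes>\<^bsub>H\<^esub> z)"
    using continuous_map_compose[OF _ m, of T "\<lambda>z. (inv\<^bsub>H\<^esub> d, z)"]
    by (simp add: continuous_map_pairwise o_def)
  from openin_continuous_map_preimage[OF this assms(2)] show ?thesis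
    by (simp add: ts)
qed

text \<open>Continuity at the identity gives \<open>V\<close> with \<open>inv a * b * inv c\<close>
  in \<open>U\<close> for all \<open>a\<close>, \<open>b\<close>, \<open>c\<close> in
  \<open>V\<close>. If \<open>y\<close> is in the closure of \<open>dV\<close>, the neighbourhood
  \<open>yV\<close> of \<open>y\<close> meets \<open>dV\<close> in some \<open>z\<close>. With
  \<open>a = inv d * x\<close>, \<open>b = inv d * z\<close>, \<open>c = inv y * z\<close> the
  product collapses to \<open>inv x * y\<close>. One \<open>V\<close> serves all centres
  \<open>d\<close>, which is what the covering arguments below rely on.\<close>

lemma closure_of_translate:
  assumes tg: "topological_group H T" and U: "openin T U" "\<one>\<^bsub>H\<^esub> \<in> U"
  obtains V where "openin T V" "\<one>\<^bsub>H\<^esub> \<in> V"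
    "\<And>d x y. \<lbrakk>d \<in> carrier H; x \<in> carrier H; inv\<^bsub>H\<^esub> d \<otimes>\<^bsub>H\<^esub> x \<in> V;
       y \<in> T closure_of {z \<in> carrier H. inv\<^bsub>H\<^esub> d \<otimes>\<^bsub>H\<^esub> z \<in> V}\<rbrakk> \<Longrightarrow> inv\<^bsub>H\<^esub> x \<otimes>\<^bsub>H\<^esub> y \<in> U"
proof -
  have m: "continuous_map (prod_topology T T) T (\<lambda>(x, y). x \<otimes>\<^bsub>H\<^esub> y)"
    and i: "continuous_map T T (\<lambda>x. inv\<^bsub>H\<^esub> x)" and ts: "topspace T = carrier H"
    using tg by (auto simp: topological_group_def)
  interpret group H using tg by (auto simp: topological_group_def)
  have cancel: "a \<otimes>\<^bsub>H\<^esub> (inv\<^bsub>H\<^esub> a \<otimes>\<^bsub>H\<^esub> b) = b"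
    if "a \<in> carrier H" "b \<in> carrier H" for a b
    using that by (simp flip: m_assoc)
  let ?P = "prod_topology T (prod_topology T T)"
  have c: "continuous_map X T (\<lambda>p. f p \<otimes>\<^bsub>H\<^esub> g p)"
    if "continuous_map X T f" "continuous_map X T g" for X :: "('a \<times> 'a \<times> 'a) topology" and f g
    using continuous_map_compose[OF _ m, of X "\<lambda>p. (f p, g p)"] that
    by (simp add: continuous_map_pairwise o_def)
  have "continuous_map ?P T (\<lambda>p. (inv\<^bsub>H\<^esub> (fst p) \<otimes>\<^bsub>H\<^esub> fst (snd p)) \<otimes>\<^bsub>H\<^esub> inv\<^bsub>H\<^esub> (snd (snd p)))"
    by (intro c continuous_map_compose[OF _ i, unfolded o_def] continuous_intros
        continuous_map_fst continuous_map_snd continuous_map_fst_of continuous_map_snd_of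
        continuous_map_compose[OF continuous_map_snd continuous_map_fst, unfolded o_def]
        continuous_map_compose[OF continuous_map_snd continuous_map_snd, unfolded o_def])
  from openin_continuous_map_preimage[OF this U(1)]
  obtain A B where "openin T A" "openin (prod_topology T T) B" "\<one>\<^bsub>H\<^esub> \<in> A" "(\<one>\<^bsub>H\<^esub>, \<one>\<^bsub>H\<^esub>) \<in> B"
    and AB: "A \<times> B \<subseteq> {p \<in> topspace ?P. (inv\<^bsub>H\<^esub> (fst p) \<otimes>\<^bsub>H\<^esub> fst (snd p)) \<otimes>\<^bsub>H\<^esub> inv\<^bsub>H\<^esub> (snd (snd p)) \<in> U}"
    unfolding openin_prod_topology_alt[of T "prod_topology T T"] using U(2) ts
    by (elim allE[of _ "\<one>\<^bsub>H\<^esub>"] allE[of _ "(\<one>\<^bsub>H\<^esub>, \<one>\<^bsub>H\<^esub>)"]) auto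
  moreover then obtain C D where "openin T C" "openin T D" "\<one>\<^bsub>H\<^esub> \<in> C" "\<one>\<^bsub>H\<^esub> \<in> D" "C \<times> D \<subseteq> B"
    unfolding openin_prod_topology_alt by metis
  ultimately have V: "openin T (A \<inter> C \<inter> D)" "\<one>\<^bsub>H\<^esub> \<in> A \<inter> C \<inter> D"
    and ABCD: "A \<times> (C \<times> D) \<subseteq> {p \<in> topspace ?P. (inv\<^bsub>H\<^esub> (fst p) \<otimes>\<^bsub>H\<^esub> fst (snd p)) \<otimes>\<^bsub>H\<^esub> inv\<^bsub>H\<^esub> (snd (snd p)) \<in> U}"
    by auto
  define V where "V = A \<inter> C \<inter> D"
  have VU: "inv\<^bsub>H\<^esub> a \<otimes>\<^bsub>H\<^esub> b \<otimes>\<^bsub>H\<^esub> inv\<^bsub>H\<^esub> c \<in> U" if "a \<in> V" "b \<in> V" "c \<in> V" for a b c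
    using subsetD[OF ABCD, of "(a, b, c)"] that by (simp add: V_def)
  show ?thesis
  proof
    show "openin T V" "\<one>\<^bsub>H\<^esub> \<in> V" using V by (auto simp: V_def)
    fix d x y
    assume d: "d \<in> carrier H" and x: "x \<in> carrier H" "inv\<^bsub>H\<^esub> d \<otimes>\<^bsub>H\<^esub> x \<in> V"
      and y: "y \<in> T closure_of {z \<in> carrier H. inv\<^bsub>H\<^esub> d \<otimes>\<^bsub>H\<^esub> z \<in> V}"
    then have yc: "y \<in> carrier H" using ts by (auto simp: in_closure_of)
    have "openin T {z \<in> carrier H. inv\<^bsub>H\<^esub> y \<otimes>\<^bsub>H\<^esub> z \<in> V}"
      using openin_translate[OF tg _ yc] V(1) unfolding V_def by blast
    moreover have "y \<in> {z \<in> carrier H. inv\<^bsub>H\<^esub> y \<otimes>\<^bsub>H\<^esub> z \<in> V}"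
      using V(2) V_def yc by auto
    ultimately have "\<exists>z. z \<in> {z \<in> carrier H. inv\<^bsub>H\<^esub> d \<otimes>\<^bsub>H\<^esub> z \<in> V} \<and> z \<in> {z \<in> carrier H. inv\<^bsub>H\<^esub> y \<otimes>\<^bsub>H\<^esub> z \<in> V}"
      using y by (simp only: in_closure_of)
    then obtain z where z: "z \<in> carrier H" "inv\<^bsub>H\<^esub> d \<otimes>\<^bsub>H\<^esub> z \<in> V" "inv\<^bsub>H\<^esub> y \<otimes>\<^bsub>H\<^esub> z \<in> V"
      by blast
    have "inv\<^bsub>H\<^esub> (inv\<^bsub>H\<^esub> d \<otimes>\<^bsub>H\<^esub> x) \<otimes>\<^bsub>H\<^esub> (inv\<^bsub>H\<^esub> d \<otimes>\<^bsub>H\<^esub> z) \<otimes>\<^bsub>H\<^esub> inv\<^bsub>H\<^esub> (inv\<^bsub>H\<^esub> y \<otimes>\<^bsub>H\<^esub> z) \<in> U"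
      using VU x(2) z(2,3) .
    moreover have "inv\<^bsub>H\<^esub> (inv\<^bsub>H\<^esub> d \<otimes>\<^bsub>H\<^esub> x) \<otimes>\<^bsub>H\<^esub> (inv\<^bsub>H\<^esub> d \<otimes>\<^bsub>H\<^esub> z) \<otimes>\<^bsub>H\<^esub> inv\<^bsub>H\<^esub> (inv\<^bsub>H\<^esub> y \<otimes>\<^bsub>H\<^esub> z)
        = inv\<^bsub>H\<^esub> x \<otimes>\<^bsub>H\<^esub> y"
      using d x z yc by (simp add: inv_mult_group m_assoc cancel)
    ultimately show "inv\<^bsub>H\<^esub> x \<otimes>\<^bsub>H\<^esub> y \<in> U" by simp
  qed
qed

lemma topological_group_imp_regular_space:
  assumes tg: "topological_group H T"
  shows "regular_space T"
  unfolding regular_space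
proof (intro allI impI, elim conjE)
  fix C a assume C: "closedin T C" and a: "a \<in> topspace T - C"
  have ts: "topspace T = carrier H" using tg by (auto simp: topological_group_def)
  interpret group H using tg by (auto simp: topological_group_def)
  \<comment> \<open>The complement of \<open>C\<close> translated back to the identity; the double
    inverse comes from \<open>openin_translate\<close> at \<open>inv a\<close>. Taking
    \<open>d = x = a\<close> below puts \<open>inv a * y\<close> into \<open>?U\<close>, that is,
    \<open>y\<close> outside \<open>C\<close>.\<close>
  let ?U = "{z \<in> carrier H. inv\<^bsub>H\<^esub> (inv\<^bsub>H\<^esub> a) \<otimes>\<^bsub>H\<^esub> z \<in> topspace T - C}"
  have "openin T ?U"
    using openin_diff[OF openin_topspace C] a ts by (intro openin_translate[OF tg]) auto
  moreover have "\<one>\<^bsub>H\<^esub> \<in> ?U" using a ts by simp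
  ultimately obtain V where V: "openin T V" "\<one>\<^bsub>H\<^esub> \<in> V"
    "\<And>d x y. \<lbrakk>d \<in> carrier H; x \<in> carrier H; inv\<^bsub>H\<^esub> d \<otimes>\<^bsub>H\<^esub> x \<in> V;
       y \<in> T closure_of {z \<in> carrier H. inv\<^bsub>H\<^esub> d \<otimes>\<^bsub>H\<^esub> z \<in> V}\<rbrakk> \<Longrightarrow> inv\<^bsub>H\<^esub> x \<otimes>\<^bsub>H\<^esub> y \<in> ?U"
    by (rule closure_of_translate[OF tg]) blast
  have "y \<notin> C" if "y \<in> T closure_of {z \<in> carrier H. inv\<^bsub>H\<^esub> a \<otimes>\<^bsub>H\<^esub> z \<in> V}" for y
  proof -
    have "y \<in> carrier H" using that ts by (auto simp: in_closure_of)
    then show ?thesis using V(3)[of a a y] that a ts V(2) by (simp add: flip: m_assoc)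
  qed
  then show "\<exists>U. openin T U \<and> a \<in> U \<and> disjnt C (T closure_of U)"
    using a ts V by (intro exI[of _ "{z \<in> carrier H. inv\<^bsub>H\<^esub> a \<otimes>\<^bsub>H\<^esub> z \<in> V}"])
      (auto simp: openin_translate[OF tg] disjnt_iff)
qed

lemma topological_group_subgroup:
  assumes tg: "topological_group H T" and G: "subgroup G H"
  shows "topological_group (H\<lparr>carrier := G\<rparr>) (subtopology T G)"
proof -
  have m: "continuous_map (prod_topology T T) T (\<lambda>(x, y). x \<otimes>\<^bsub>H\<^esub> y)"
    and i: "continuous_map T T (\<lambda>x. inv\<^bsub>H\<^esub> x)" and ts: "topspace T = carrier H" and gr: "group H"
    using tg by (auto simp: topological_group_def)
  have "G \<subseteq> carrier H" using G by (rule subgroup.subset)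
  have "continuous_map (prod_topology (subtopology T G) (subtopology T G)) (subtopology T G) (\<lambda>(x, y). x \<otimes>\<^bsub>H\<^esub> y)"
    using continuous_map_from_subtopology[OF m, of "G \<times> G"] subgroup.m_closed[OF G]
    by (auto simp: subtopology_Times continuous_map_in_subtopology)
  moreover have "continuous_map (subtopology T G) (subtopology T G) (\<lambda>x. inv\<^bsub>H\<lparr>carrier := G\<rparr>\<^esub> x)"
  \<comment> \<open>The inverse of the restricted structure is a different term, identified with the
    inverse of \<open>H\<close> on \<open>G\<close> only.\<close>
  proof (rule continuous_map_eq)
    show "continuous_map (subtopology T G) (subtopology T G) (\<lambda>x. inv\<^bsub>H\<^esub> x)"
      using continuous_map_from_subtopology[OF i, of G] subgroup.m_inv_closed[OF G]
      by (auto simp: continuous_map_in_subtopology)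
  qed (use group.m_inv_consistent[OF gr G] in auto)
  ultimately show ?thesis
    using group.subgroup_imp_group[OF gr G] \<open>G \<subseteq> carrier H\<close> ts
    by (auto simp: topological_group_def)
qed

section \<open>Weight of subspaces and of groups with a dense subgroup\<close>

lemma ordLeq_Sigma_infinite:
  assumes "infinite B" "|I| \<le>o |B|" "\<And>i. i \<in> I \<Longrightarrow> |A i| \<le>o |B|" "S \<subseteq> f ` (Sigma I A)"
  shows "|S| \<le>o |B|"
  by (rule ordLeq_transitive[OF surj_imp_ordLeq[OF assms(4)] card_of_Sigma_ordLeq_infinite])
    (use assms in auto)

lemma is_baseE:
  assumes "is_base X B" "openin X U" "x \<in> U"
  obtains V where "V \<in> B" "x \<in> V" "V \<subseteq> U"
  using assms unfolding is_base_def by meson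

lemma is_base_openin: "is_base X B \<Longrightarrow> U \<in> B \<Longrightarrow> openin X U"
  by (simp add: is_base_def)

lemma weight_le_subtopology:
  assumes "weight_le T A"
  shows "weight_le (subtopology T S) A"
proof -
  obtain B where B: "is_base T B" "|B| \<le>o |A|" using assms by (auto simp: weight_le_def)
  have "is_base (subtopology T S) ((\<inter>) S ` B)"
    unfolding is_base_def
  proof (intro conjI ballI allI impI)
    fix U assume "U \<in> (\<inter>) S ` B"
    then show "openin (subtopology T S) U"
      using B(1) unfolding is_base_def openin_subtopology_alt by auto
  next
    fix U x assume "openin (subtopology T S) U" "x \<in> U"
    then obtain W where "openin T W" "U = W \<inter> S" "x \<in> W" "x \<in> S"
      unfolding openin_subtopology by blast
    moreover then obtain V where "V \<in> B" "x \<in> V" "V \<subseteq> W"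
      using is_baseE[OF B(1)] by metis
    ultimately show "\<exists>V\<in>(\<inter>) S ` B. x \<in> V \<and> V \<subseteq> U"
      by (intro bexI[of _ "S \<inter> V"]) auto
  qed
  moreover have "|(\<inter>) S ` B| \<le>o |A|"
    by (rule ordLeq_transitive[OF card_of_image B(2)])
  ultimately show ?thesis by (auto simp: weight_le_def)
qed

lemma weight_le_of_dense_subgroup:
  assumes tg: "topological_group H T" and G: "subgroup G H" and dense: "T closure_of G = topspace T"
    and w: "weight_le (subtopology T G) A" and A: "infinite A"
  shows "weight_le T A"
proof -
  have ts: "topspace T = carrier H" using tg by (auto simp: topological_group_def)
  interpret group H using tg by (auto simp: topological_group_def)
  have Gc: "G \<subseteq> carrier H" and G1: "\<one>\<^bsub>H\<^esub> \<in> G" using G by (auto simp: subgroup_def)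
  obtain B where B: "is_base (subtopology T G) B" "|B| \<le>o |A|" using w by (auto simp: weight_le_def)
  define W where "W S = T interior_of (T closure_of S)" for S
  \<comment> \<open>One point from each basic set: over the nonempty members of \<open>B\<close>
    these points are dense in \<open>T\<close>, and there are at most \<open>|B|\<close> of
    them.\<close>
  define p where "p S = (SOME x. x \<in> S)" for S :: "'a set"
  have dense': "\<exists>S\<in>B. S \<noteq> {} \<and> S \<subseteq> G \<and> S \<subseteq> O'" if "openin T O'" "O' \<noteq> {}" for O'
  proof -
    have "O' \<inter> G \<noteq> {}" using that dense by (metis dense_intersects_open inf_commute)
    moreover have "openin (subtopology T G) (O' \<inter> G)" using that openin_subtopology by blast
    moreover obtain x where "x \<in> O' \<inter> G" using calculation(1) by blast
    ultimately obtain S where "S \<in> B" "x \<in> S" "S \<subseteq> O' \<inter> G"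
      using is_baseE[OF B(1)] by metis
    then show ?thesis by blast
  qed
  have local_base: "\<exists>S\<in>B. \<one>\<^bsub>H\<^esub> \<in> W S \<and> W S \<subseteq> U" if U: "openin T U" "\<one>\<^bsub>H\<^esub> \<in> U" for U
  proof -
    have "closedin T (topspace T - U)" "\<one>\<^bsub>H\<^esub> \<in> topspace T - (topspace T - U)"
      using closedin_diff[OF closedin_topspace U(1)] U(2) ts by auto
    then obtain V where V: "openin T V" "\<one>\<^bsub>H\<^esub> \<in> V" "disjnt (topspace T - U) (T closure_of V)"
      using topological_group_imp_regular_space[OF tg] unfolding regular_space by meson
    have VU: "T closure_of V \<subseteq> U"
      using V(3) closure_of_subset_topspace[of T V] by (auto simp: disjnt_iff)
    have "openin (subtopology T G) (V \<inter> G)" using V(1) openin_subtopology by blast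
    then obtain S where S: "S \<in> B" "\<one>\<^bsub>H\<^esub> \<in> S" "S \<subseteq> V \<inter> G"
      using is_baseE[OF B(1)] V(2) G1 by (metis IntI)
    then obtain O' where O': "openin T O'" "S = O' \<inter> G"
      using is_base_openin[OF B(1)] unfolding openin_subtopology by blast
    \<comment> \<open>Density of \<open>G\<close> puts \<open>O'\<close> inside the closure of
      \<open>O' \<inter> G = S\<close>, so \<open>O'\<close> is an open set witnessing that the
      identity is interior to that closure.\<close>
    have "O' \<subseteq> T closure_of S"
      using openin_Int_closure_of_subset[OF O'(1), of G] dense O' openin_subset[OF O'(1)] by auto
    then have "\<one>\<^bsub>H\<^esub> \<in> W S" unfolding W_def using O' S(2) interior_of_maximal by blast
    moreover have "W S \<subseteq> U"
      unfolding W_def using interior_of_subset[of T "T closure_of S"] closure_of_mono[of S V T] S(3) VU by blast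
    ultimately show ?thesis using S(1) by blast
  qed
  define tr where "tr = (\<lambda>(S, R). {z \<in> carrier H. inv\<^bsub>H\<^esub> (p S) \<otimes>\<^bsub>H\<^esub> z \<in> W R})"
  define \<B> where "\<B> = tr ` (SIGMA S:B \<inter> {S. S \<noteq> {} \<and> S \<subseteq> G}. B)"
  have p: "p S \<in> S" if "S \<noteq> {}" for S using that unfolding p_def by (simp add: some_in_eq)
  have "is_base T \<B>"
    unfolding is_base_def
  proof (intro conjI ballI allI impI)
    fix U assume "U \<in> \<B>"
    then show "openin T U" unfolding \<B>_def tr_def using p Gc
      by (auto simp: W_def intro!: openin_translate[OF tg])
  next
    fix U x assume U: "openin T U" "x \<in> U"
    have x: "x \<in> carrier H" using U openin_subset ts by blast
    let ?U = "{z \<in> carrier H. inv\<^bsub>H\<^esub> (inv\<^bsub>H\<^esub> x) \<otimes>\<^bsub>H\<^esub> z \<in> U}"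
    have "openin T ?U" by (rule openin_translate[OF tg U(1)]) (use x in auto)
    moreover have "\<one>\<^bsub>H\<^esub> \<in> ?U" using x U(2) by simp
    ultimately obtain V where V: "openin T V" "\<one>\<^bsub>H\<^esub> \<in> V"
      "\<And>d x y. \<lbrakk>d \<in> carrier H; x \<in> carrier H; inv\<^bsub>H\<^esub> d \<otimes>\<^bsub>H\<^esub> x \<in> V;
         y \<in> T closure_of {z \<in> carrier H. inv\<^bsub>H\<^esub> d \<otimes>\<^bsub>H\<^esub> z \<in> V}\<rbrakk> \<Longrightarrow> inv\<^bsub>H\<^esub> x \<otimes>\<^bsub>H\<^esub> y \<in> ?U"
      by (rule closure_of_translate[OF tg]) blast
    obtain R where R: "R \<in> B" "\<one>\<^bsub>H\<^esub> \<in> W R" "W R \<subseteq> V" using local_base V by blast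
    \<comment> \<open>These are the centres \<open>z\<close> for which the translate of
      \<open>W R\<close> by \<open>z\<close> contains \<open>x\<close>. They form an open set around
      \<open>x\<close>, so some centre \<open>p S\<close> is among them.\<close>
    let ?O = "{z \<in> carrier H. inv\<^bsub>H\<^esub> z \<otimes>\<^bsub>H\<^esub> x \<in> W R}"
    have "continuous_map T T (\<lambda>z. inv\<^bsub>H\<^esub> z \<otimes>\<^bsub>H\<^esub> x)"
      using tg x continuous_map_compose[of T "prod_topology T T" "\<lambda>z. (inv\<^bsub>H\<^esub> z, x)" T "\<lambda>(x, y). x \<otimes>\<^bsub>H\<^esub> y"]
      by (simp add: topological_group_def continuous_map_pairwise o_def)
    from openin_continuous_map_preimage[OF this, of "W R"] have "openin T ?O"
      by (simp add: W_def ts)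
    moreover have "x \<in> ?O" using x R by simp
    ultimately obtain S where S: "S \<in> B" "S \<noteq> {}" "S \<subseteq> G" "S \<subseteq> ?O" using dense' by blast
    then have pS: "p S \<in> carrier H" "inv\<^bsub>H\<^esub> (p S) \<otimes>\<^bsub>H\<^esub> x \<in> W R" using p by auto
    have "y \<in> U" if "y \<in> tr (S, R)" for y
    proof -
      have y: "y \<in> carrier H" "inv\<^bsub>H\<^esub> (p S) \<otimes>\<^bsub>H\<^esub> y \<in> V" using that R by (auto simp: tr_def)
      then have "y \<in> T closure_of {z \<in> carrier H. inv\<^bsub>H\<^esub> (p S) \<otimes>\<^bsub>H\<^esub> z \<in> V}"
        using closure_of_subset[of "{z \<in> carrier H. inv\<^bsub>H\<^esub> (p S) \<otimes>\<^bsub>H\<^esub> z \<in> V}" T] ts by auto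
      then have "inv\<^bsub>H\<^esub> x \<otimes>\<^bsub>H\<^esub> y \<in> ?U" using V(3)[OF pS(1) x] pS R by blast
      then show ?thesis using x y by (simp flip: m_assoc)
    qed
    moreover have "tr (S, R) \<in> \<B>" unfolding \<B>_def using S R by blast
    moreover have "x \<in> tr (S, R)" using pS x by (simp add: tr_def)
    ultimately show "\<exists>V\<in>\<B>. x \<in> V \<and> V \<subseteq> U" by blast
  qed
  moreover have "|\<B>| \<le>o |A|"
    unfolding \<B>_def
    by (rule ordLeq_Sigma_infinite[OF A ordLeq_transitive[OF card_of_mono1 B(2)] B(2) subset_refl]) auto
  ultimately show ?thesis by (auto simp: weight_le_def)
qed

section \<open>Compact networks in Lindelof Sigma-spaces\<close>

text \<open>A network modulo some cover by compact sets, the cover being left implicit.\<close>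
definition compact_network :: "'a topology \<Rightarrow> 'a set set \<Rightarrow> bool" where
  "compact_network X \<N> \<longleftrightarrow> (\<forall>x\<in>topspace X. \<exists>C. compactin X C \<and> x \<in> C \<and>
     (\<forall>U. openin X U \<and> C \<subseteq> U \<longrightarrow> (\<exists>S\<in>\<N>. x \<in> S \<and> S \<subseteq> U)))"

lemma compact_networkE:
  assumes "compact_network X \<N>" "x \<in> topspace X"
  obtains C where "compactin X C" "x \<in> C"
    "\<And>U. openin X U \<Longrightarrow> C \<subseteq> U \<Longrightarrow> \<exists>S\<in>\<N>. x \<in> S \<and> S \<subseteq> U"
  using bspec[OF assms(1)[unfolded compact_network_def] assms(2)] by metis

text \<open>The intersection of all members of \<open>\<F>\<close> through \<open>e y\<close> misses
  the remainder of \<open>K\<close>, so it pulls back to a compact set \<open>C\<close> in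
  \<open>Y\<close>. The complement in \<open>K\<close> of a neighbourhood of this intersection is
  compact, hence finitely many of those members already intersect inside the neighbourhood. Traces
  of finite intersections therefore suffice as a network.\<close>

lemma lindelof_sigma_imp_compact_network:
  assumes "lindelof_sigma Y"
  obtains \<N> where "countable \<N>" "compact_network Y \<N>"
proof -
  obtain K :: "'a set set topology" and e \<F> where sc: "stone_cech Y K e" and \<F>: "countable \<F>"
    and cl: "\<And>F. F \<in> \<F> \<Longrightarrow> closedin K F"
    and sep: "\<And>y z. y \<in> topspace Y \<Longrightarrow> z \<in> topspace K - e ` topspace Y \<Longrightarrow> \<exists>F\<in>\<F>. e y \<in> F \<and> z \<notin> F"
    using assms unfolding lindelof_sigma_def by metis
  have K: "compact_space K" and emb: "embedding_map Y K e"
    using sc by (auto simp: stone_cech_def)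
  let ?E = "subtopology K (e ` topspace Y)"
  have hom: "homeomorphic_map Y ?E e" using emb by (simp add: embedding_map_def)
  then obtain g where g: "homeomorphic_maps Y ?E e g" using homeomorphic_map_maps by blast
  have eY: "e ` topspace Y \<subseteq> topspace K"
    using continuous_map_image_subset_topspace[OF homeomorphic_imp_continuous_map[OF hom]] by auto
  \<comment> \<open>The empty subfamily is allowed and contributes all of \<open>topspace Y\<close>,
    since \<open>\<Inter>{}\<close> is \<open>UNIV\<close>.\<close>
  define \<N> where "\<N> = (\<lambda>\<S>. {y \<in> topspace Y. e y \<in> \<Inter>\<S>}) ` {\<S>. finite \<S> \<and> \<S> \<subseteq> \<F>}"
  have "countable \<N>"
    unfolding \<N>_def using countable_Collect_finite_subset[OF \<F>] by (simp add: conj_commute)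
  moreover have "compact_network Y \<N>"
    unfolding compact_network_def
  proof (intro ballI exI conjI allI impI)
    fix y assume y: "y \<in> topspace Y"
    define \<F>y where "\<F>y = {F \<in> \<F>. e y \<in> F}"
    define C where "C = {x \<in> topspace Y. e x \<in> \<Inter>\<F>y}"
    \<comment> \<open>The factor \<open>topspace K\<close> matters when \<open>\<F>y\<close> is
      empty.\<close>
    define D where "D = topspace K \<inter> \<Inter>\<F>y"
    have clD: "closedin K D"
    proof -
      have "closedin K (\<Inter>(insert (topspace K) \<F>y))"
        by (rule closedin_Inter) (use cl in \<open>auto simp: \<F>y_def\<close>)
      then show ?thesis by (simp add: D_def)
    qed
    have D: "D \<subseteq> e ` topspace Y"
    proof
      fix z assume z: "z \<in> D"
      show "z \<in> e ` topspace Y"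
      proof (rule ccontr)
        assume "z \<notin> e ` topspace Y"
        then obtain F where "F \<in> \<F>" "e y \<in> F" "z \<notin> F" using sep[OF y, of z] z by (auto simp: D_def)
        then show False using z by (auto simp: D_def \<F>y_def)
      qed
    qed
    have ge: "g (e x) = x" if "x \<in> topspace Y" for x using g that by (simp add: homeomorphic_maps_def)
    have C_eq: "C = g ` D"
    proof
      show "C \<subseteq> g ` D"
      proof
        fix x assume x: "x \<in> C"
        then have "e x \<in> D" using eY by (auto simp: C_def D_def)
        then show "x \<in> g ` D" by (rule rev_image_eqI) (use ge[of x] x in \<open>auto simp: C_def\<close>)
      qed
      show "g ` D \<subseteq> C"
      proof clarify
        fix z assume z: "z \<in> D"
        then obtain x where "x \<in> topspace Y" "z = e x" using D by blast
        then show "g z \<in> C" using z ge[of x] by (simp add: C_def D_def)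
      qed
    qed
    have "compactin ?E D"
      using closedin_compact_space[OF K clD] D by (simp add: compactin_subtopology)
    then show "compactin Y C"
      unfolding C_eq by (rule image_compactin) (use g in \<open>simp add: homeomorphic_maps_def\<close>)
    show "y \<in> C" using y by (simp add: C_def \<F>y_def)
    fix U assume "openin Y U \<and> C \<subseteq> U"
    then have U: "openin Y U" "C \<subseteq> U" by auto
    have "openin ?E (e ` U)" using homeomorphic_imp_open_map[OF hom] U(1) by (simp add: open_map_def)
    then obtain W where W: "openin K W" "e ` U = W \<inter> e ` topspace Y" unfolding openin_subtopology by metis
    have "D \<subseteq> W"
    proof
      fix z assume z: "z \<in> D"
      then obtain x where x: "x \<in> topspace Y" "z = e x" using D by blast
      then have "x \<in> C" using z by (simp add: C_def D_def)
      then show "z \<in> W" using U(2) W(2) x(2) by blast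
    qed
    have "compactin K (topspace K - W)" by (rule closedin_compact_space[OF K]) (use W in auto)
    moreover have "topspace K - W \<subseteq> \<Union>((\<lambda>F. topspace K - F) ` \<F>y)" using \<open>D \<subseteq> W\<close> by (auto simp: D_def)
    moreover have "\<And>V. V \<in> (\<lambda>F. topspace K - F) ` \<F>y \<Longrightarrow> openin K V" using cl by (auto simp: \<F>y_def)
    ultimately obtain \<V> where "finite \<V>" "\<V> \<subseteq> (\<lambda>F. topspace K - F) ` \<F>y" "topspace K - W \<subseteq> \<Union>\<V>"
      using compactinD by metis
    then obtain \<S> where \<S>: "finite \<S>" "\<S> \<subseteq> \<F>y" "topspace K - W \<subseteq> \<Union>((\<lambda>F. topspace K - F) ` \<S>)"
      using finite_subset_image by metis
    have "{x \<in> topspace Y. e x \<in> \<Inter>\<S>} \<in> \<N>" using \<S> by (auto simp: \<N>_def \<F>y_def)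
    moreover have "y \<in> {x \<in> topspace Y. e x \<in> \<Inter>\<S>}" using y \<S> by (auto simp: \<F>y_def)
    moreover have "{x \<in> topspace Y. e x \<in> \<Inter>\<S>} \<subseteq> U"
    proof clarify
      fix x assume x: "x \<in> topspace Y" "e x \<in> \<Inter>\<S>"
      then have "e x \<in> W" using \<S>(3) eY by auto
      then have "e x \<in> e ` U" using W(2) x(1) by simp
      then obtain u where "u \<in> U" "e x = e u" by blast
      moreover have "u \<in> topspace Y" using \<open>u \<in> U\<close> openin_subset[OF U(1)] by blast
      ultimately have "x = u" using ge[OF x(1)] ge[of u] by metis
      then show "x \<in> U" using \<open>u \<in> U\<close> by simp
    qed
    ultimately show "\<exists>S\<in>\<N>. y \<in> S \<and> S \<subseteq> U" by (intro bexI conjI)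
  qed
  ultimately show thesis by (rule that)
qed

text \<open>A finite subfamily of the cover contains the compact set \<open>C\<close> around
  \<open>x\<close>, so its union contains a network element through \<open>x\<close>. It is enough
  to choose one finite subfamily for each of the countably many network elements that have
  one.\<close>

lemma compact_network_imp_Lindelof_space:
  assumes "countable \<N>" "compact_network X \<N>"
  shows "Lindelof_space X"
  unfolding Lindelof_space_alt
proof (intro allI impI, elim conjE)
  fix \<U> assume op: "\<forall>U\<in>\<U>. openin X U" and cov: "topspace X \<subseteq> \<Union>\<U>"
  define \<M> where "\<M> = {S \<in> \<N>. \<exists>\<V>. finite \<V> \<and> \<V> \<subseteq> \<U> \<and> S \<subseteq> \<Union>\<V>}"
  have "\<forall>S\<in>\<M>. \<exists>\<V>. finite \<V> \<and> \<V> \<subseteq> \<U> \<and> S \<subseteq> \<Union>\<V>" by (simp add: \<M>_def)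
  then obtain f where f: "\<And>S. S \<in> \<M> \<Longrightarrow> finite (f S) \<and> f S \<subseteq> \<U> \<and> S \<subseteq> \<Union>(f S)"
    by metis
  have "countable (\<Union>(f ` \<M>))"
    using assms(1) f by (intro countable_UN) (auto simp: \<M>_def intro: countable_finite)
  moreover have "\<Union>(f ` \<M>) \<subseteq> \<U>" using f by blast
  moreover have "x \<in> \<Union>(\<Union>(f ` \<M>))" if x: "x \<in> topspace X" for x
  proof -
    obtain C where C: "compactin X C" "x \<in> C"
      "\<And>U. openin X U \<Longrightarrow> C \<subseteq> U \<Longrightarrow> \<exists>S\<in>\<N>. x \<in> S \<and> S \<subseteq> U"
      using compact_networkE[OF assms(2) x] by metis
    have "C \<subseteq> \<Union>\<U>" using compactin_subset_topspace[OF C(1)] cov by blast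
    then obtain \<V> where \<V>: "finite \<V>" "\<V> \<subseteq> \<U>" "C \<subseteq> \<Union>\<V>" using compactinD[OF C(1)] op by metis
    moreover have "openin X (\<Union>\<V>)" using op \<V> by (intro openin_Union) blast
    ultimately obtain S where "S \<in> \<N>" "x \<in> S" "S \<subseteq> \<Union>\<V>" using C(3) by metis
    then have "S \<in> \<M>" using \<V> by (auto simp: \<M>_def)
    then show ?thesis using f[of S] \<open>x \<in> S\<close> by blast
  qed
  ultimately show "\<exists>\<V>. countable \<V> \<and> \<V> \<subseteq> \<U> \<and> topspace X \<subseteq> \<Union>\<V>"
    by (intro exI[of _ "\<Union>(f ` \<M>)"] conjI) (assumption | rule subsetI)+
qed

section \<open>Separating compact sets by disjoint open pairs\<close>

definition disjoint_open_pairs :: "'a topology \<Rightarrow> ('a set \<times> 'a set) set" where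
  "disjoint_open_pairs X = {(U, V). openin X U \<and> openin X V \<and> disjnt U V}"

text \<open>Meets for the order given by inclusion in the first coordinate and reverse inclusion in
  the second. The factor \<open>topspace X\<close> makes the empty meet the open pair
  \<open>(topspace X, {})\<close>.\<close>

definition finite_meets :: "'a topology \<Rightarrow> ('a set \<times> 'a set) set \<Rightarrow> ('a set \<times> 'a set) set" where
  "finite_meets X P = (\<lambda>S. (topspace X \<inter> \<Inter>(fst ` S), \<Union>(snd ` S))) ` {S. S \<subseteq> P \<and> finite S}"

lemma finite_meets_disjoint_open_pairs:
  assumes "P \<subseteq> disjoint_open_pairs X"
  shows "finite_meets X P \<subseteq> disjoint_open_pairs X"
proof
  fix q assume "q \<in> finite_meets X P"
  then obtain S where S: "S \<subseteq> P" "finite S" and q: "q = (topspace X \<inter> \<Inter>(fst ` S), \<Union>(snd ` S))"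
    by (auto simp: finite_meets_def)
  have *: "openin X (fst p)" "openin X (snd p)" "disjnt (fst p) (snd p)" if "p \<in> S" for p
    using that S assms by (auto simp: disjoint_open_pairs_def)
  have "openin X (\<Inter>(insert (topspace X) (fst ` S)))"
    by (rule openin_Inter) (use * S in auto)
  moreover have "openin X (\<Union>(snd ` S))"
    by (rule openin_Union) (use * in auto)
  ultimately show "q \<in> disjoint_open_pairs X"
    using * by (auto simp: q disjoint_open_pairs_def disjnt_iff)
qed

lemma swap_disjoint_open_pairs:
  "P \<subseteq> disjoint_open_pairs X \<Longrightarrow> prod.swap ` P \<subseteq> disjoint_open_pairs X"
  by (auto simp: disjoint_open_pairs_def disjnt_sym)

text \<open>Finitely many second coordinates cover \<open>B\<close>, and \<open>A\<close> lies in
  all the matching first coordinates. The set \<open>A\<close> is kept general because it is a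
  singleton in one application and a compact set in the next.\<close>

lemma finite_meets_separate_compact:
  assumes P: "P \<subseteq> disjoint_open_pairs X" and B: "compactin X B" and A: "A \<subseteq> topspace X"
    and sep: "\<And>y. y \<in> B \<Longrightarrow> \<exists>p\<in>P. A \<subseteq> fst p \<and> y \<in> snd p"
  shows "\<exists>p\<in>finite_meets X P. A \<subseteq> fst p \<and> B \<subseteq> snd p"
proof -
  define Q where "Q = {p \<in> P. A \<subseteq> fst p}"
  have "B \<subseteq> \<Union>(snd ` Q)"
  proof
    fix y assume "y \<in> B"
    then obtain p where "p \<in> P" "A \<subseteq> fst p" "y \<in> snd p" using sep by metis
    then have "p \<in> Q" by (simp add: Q_def)
    then show "y \<in> \<Union>(snd ` Q)" using \<open>y \<in> snd p\<close> by blast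
  qed
  moreover have "\<And>U. U \<in> snd ` Q \<Longrightarrow> openin X U" using P by (auto simp: Q_def disjoint_open_pairs_def)
  ultimately obtain \<V> where "finite \<V>" "\<V> \<subseteq> snd ` Q" "B \<subseteq> \<Union>\<V>" using compactinD[OF B] by metis
  then obtain S where S: "finite S" "S \<subseteq> Q" "B \<subseteq> \<Union>(snd ` S)" using finite_subset_image by metis
  have "(topspace X \<inter> \<Inter>(fst ` S), \<Union>(snd ` S)) \<in> finite_meets X P"
    unfolding finite_meets_def using S by (intro imageI) (auto simp: Q_def)
  moreover have "A \<subseteq> topspace X \<inter> \<Inter>(fst ` S)" using A S by (auto simp: Q_def)
  ultimately show ?thesis using S(3) by (intro bexI[of _ "(topspace X \<inter> \<Inter>(fst ` S), \<Union>(snd ` S))"]) simp_all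
qed

text \<open>Swapping coordinates turns meets into joins, so these are the finite joins of finite
  meets of pairs from \<open>P\<close>.\<close>

definition finite_pair_lattice :: "'a topology \<Rightarrow> ('a set \<times> 'a set) set \<Rightarrow> ('a set \<times> 'a set) set" where
  "finite_pair_lattice X P = prod.swap ` finite_meets X (prod.swap ` finite_meets X P)"

lemma finite_pair_lattice_disjoint_open_pairs:
  "P \<subseteq> disjoint_open_pairs X \<Longrightarrow> finite_pair_lattice X P \<subseteq> disjoint_open_pairs X"
  unfolding finite_pair_lattice_def
  by (intro swap_disjoint_open_pairs finite_meets_disjoint_open_pairs)

text \<open>Compactness is used twice: first on \<open>B\<close>, with a point of \<open>A\<close>
  fixed, and then on \<open>A\<close>, with the coordinates swapped and all of \<open>B\<close> on
  the first side.\<close>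

lemma finite_pair_lattice_separates_compact:
  assumes P: "P \<subseteq> disjoint_open_pairs X" and A: "compactin X A" and B: "compactin X B"
    and sep: "\<And>x y. x \<in> A \<Longrightarrow> y \<in> B \<Longrightarrow> \<exists>p\<in>P. x \<in> fst p \<and> y \<in> snd p"
  shows "\<exists>p\<in>finite_pair_lattice X P. A \<subseteq> fst p \<and> B \<subseteq> snd p"
proof -
  have "\<exists>p\<in>prod.swap ` finite_meets X P. B \<subseteq> fst p \<and> x \<in> snd p" if x: "x \<in> A" for x
  proof -
    have "\<exists>p\<in>finite_meets X P. {x} \<subseteq> fst p \<and> B \<subseteq> snd p"
      using sep[OF x] compactin_subset_topspace[OF A] x
      by (intro finite_meets_separate_compact[OF P B]) auto
    then show ?thesis by (simp add: conj_commute)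
  qed
  then have "\<exists>p\<in>finite_meets X (prod.swap ` finite_meets X P). B \<subseteq> fst p \<and> A \<subseteq> snd p"
    by (intro finite_meets_separate_compact[OF _ A] compactin_subset_topspace[OF B]
        swap_disjoint_open_pairs finite_meets_disjoint_open_pairs P)
  then show ?thesis unfolding finite_pair_lattice_def by (simp add: conj_commute)
qed

section \<open>Countable powers of an infinite cardinal\<close>

lemma ordLeq_insert_infinite:
  assumes "infinite B" "|A| \<le>o |B|"
  shows "|insert a A| \<le>o |B|"
proof -
  have "B \<noteq> {}" using assms(1) by auto
  then have "|{a} \<union> A| \<le>o |B|"
    using assms by (intro card_of_Un_ordLeq_infinite_Field card_of_singl_ordLeq card_of_Card_order)
      (simp_all add: Field_card_of)
  then show ?thesis by simp
qed

lemma ordLeq_Func_nat: "|K| \<le>o |Func (UNIV :: nat set) K|"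
proof -
  have "K \<subseteq> (\<lambda>f. f 0) ` Func (UNIV :: nat set) K"
  proof
    fix k assume "k \<in> K"
    then show "k \<in> (\<lambda>f. f 0) ` Func (UNIV :: nat set) K"
      by (intro image_eqI[of _ _ "\<lambda>_. k"]) (auto simp: Func_def)
  qed
  then show ?thesis by (rule surj_imp_ordLeq)
qed

lemma infinite_Func_nat: "infinite K \<Longrightarrow> infinite (Func (UNIV :: nat set) K)"
  using card_of_ordLeq_infinite[OF ordLeq_Func_nat] by blast

text \<open>The arithmetic behind this is \<open>(\<kappa>\<^sup>\<omega>)\<^sup>\<omega> =
  \<kappa>\<^sup>\<omega>\<close>, obtained from a pairing of natural numbers.\<close>

lemma countable_subsets_ordLeq_Func_nat:
  fixes K :: "'k set" and P :: "'p set"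
  assumes "infinite K" "|P| \<le>o |Func (UNIV :: nat set) K|"
  shows "|{S. S \<subseteq> P \<and> countable S}| \<le>o |Func (UNIV :: nat set) K|"
proof -
  let ?F = "Func (UNIV :: nat set) K"
  \<comment> \<open>Sets with at most one element replace the elements of \<open>P\<close>, so that
    the empty set is also a union of a sequence of values. The member \<open>{}\<close> makes the
    target nonempty, as a surjection \<open>g\<close> onto it requires.\<close>
  have "|insert {} ((\<lambda>p. {p}) ` P)| \<le>o |?F|"
    by (intro ordLeq_insert_infinite infinite_Func_nat assms(1) ordLeq_transitive[OF card_of_image assms(2)])
  then obtain g where g: "g ` ?F = insert {} ((\<lambda>p. {p}) ` P)"
    using card_of_ordLeq2 by (metis insert_not_empty)
  \<comment> \<open>A single \<open>\<psi>\<close> codes a sequence of elements of \<open>?F\<close>, hence via \<open>g\<close> a sequence of sets with at most one element.\<close>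
  have "{S. S \<subseteq> P \<and> countable S} \<subseteq> (\<lambda>\<psi>. \<Union>n. g (\<lambda>m. \<psi> (prod_encode (n, m)))) ` ?F"
  proof clarify
    fix S assume S: "S \<subseteq> P" "countable S"
    obtain s :: "nat \<Rightarrow> 'p set" where s: "\<And>n. s n \<in> g ` ?F" "S = (\<Union>n. s n)"
    proof (cases "S = {}")
      case True
      then show ?thesis by (intro that[of "\<lambda>_. {}"]) (auto simp: g)
    next
      case False
      then have "range (from_nat_into S) = S" using S(2) by simp
      then show ?thesis using S(1) by (intro that[of "\<lambda>n. {from_nat_into S n}"]) (auto simp: g)
    qed
    then obtain \<phi> where \<phi>: "\<And>n. \<phi> n \<in> ?F" "\<And>n. s n = g (\<phi> n)"
      unfolding image_iff by metis
    define \<psi> where "\<psi> = (\<lambda>k. \<phi> (fst (prod_decode k)) (snd (prod_decode k)))"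
    have "\<psi> \<in> ?F" using \<phi>(1) by (auto simp: \<psi>_def Func_def)
    moreover have "S = (\<Union>n. g (\<lambda>m. \<psi> (prod_encode (n, m))))"
      using s(2) \<phi>(2) by (simp add: \<psi>_def)
    ultimately show "S \<in> (\<lambda>\<psi>. \<Union>n. g (\<lambda>m. \<psi> (prod_encode (n, m)))) ` ?F" by (intro image_eqI[where x = \<psi>])
  qed
  then show ?thesis by (rule surj_imp_ordLeq)
qed

lemma finite_meets_ordLeq_Func_nat:
  assumes "infinite K" "|P| \<le>o |Func (UNIV :: nat set) K|"
  shows "|finite_meets X P| \<le>o |Func (UNIV :: nat set) K|"
proof -
  have "|{S. S \<subseteq> P \<and> finite S}| \<le>o |Func (UNIV :: nat set) K|"
    by (rule ordLeq_transitive[OF card_of_mono1 countable_subsets_ordLeq_Func_nat[OF assms]])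
      (auto intro: countable_finite)
  then show ?thesis unfolding finite_meets_def by (rule ordLeq_transitive[OF card_of_image])
qed

lemma finite_pair_lattice_ordLeq_Func_nat:
  assumes "infinite K" "|P| \<le>o |Func (UNIV :: nat set) K|"
  shows "|finite_pair_lattice X P| \<le>o |Func (UNIV :: nat set) K|"
  unfolding finite_pair_lattice_def
  by (intro ordLeq_transitive[OF card_of_image] finite_meets_ordLeq_Func_nat assms)

section \<open>From separating pairs and a compact network to a base\<close>

lemma weight_le_of_separating_pairs:
  fixes K :: "'k set"
  assumes reg: "regular_space X" and \<N>: "countable \<N>" "compact_network X \<N>" and K: "infinite K"
    and P: "P \<subseteq> disjoint_open_pairs X" "|P| \<le>o |Func (UNIV :: nat set) K|"
    and sep: "\<And>x y. \<lbrakk>x \<in> topspace X; y \<in> topspace X; x \<noteq> y\<rbrakk> \<Longrightarrow> \<exists>p\<in>P. x \<in> fst p \<and> y \<in> snd p"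
  shows "weight_le X (Func (UNIV :: nat set) K)"
proof -
  let ?\<Lambda> = "Func (UNIV :: nat set) K"
  note inf = infinite_Func_nat[OF K]
  define Q where "Q = finite_pair_lattice X P"
  have QP: "Q \<subseteq> disjoint_open_pairs X"
    unfolding Q_def by (rule finite_pair_lattice_disjoint_open_pairs[OF P(1)])
  define f where "f = (\<lambda>(S :: 'a set, p :: 'a set \<times> 'a set). S \<inter> fst p)"
  define \<P> where "\<P> = f ` (SIGMA S:\<N>. Q)"
  have "|\<N>| \<le>o |?\<Lambda>|"
    using \<N>(1) inf unfolding countable_card_of_nat infinite_iff_card_of_nat by (rule ordLeq_transitive)
  then have \<P>: "|\<P>| \<le>o |?\<Lambda>|"
    unfolding \<P>_def
    by (rule ordLeq_Sigma_infinite[OF inf _ _ subset_refl])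
      (simp add: Q_def finite_pair_lattice_ordLeq_Func_nat[OF K P(2)])
  \<comment> \<open>Network elements are arbitrary sets, so the unions need not be open. Their
    interiors still contain every open set that the unions contain.\<close>
  define \<B> where "\<B> = (\<lambda>E. X interior_of \<Union>E) ` {E. E \<subseteq> \<P> \<and> countable E}"
  have "|\<B>| \<le>o |?\<Lambda>|"
    unfolding \<B>_def
    by (rule ordLeq_transitive[OF card_of_image countable_subsets_ordLeq_Func_nat[OF K \<P>]])
  moreover have "is_base X \<B>"
    unfolding is_base_def
  proof (intro conjI ballI allI impI)
    fix U assume "U \<in> \<B>"
    then show "openin X U" by (auto simp: \<B>_def)
  next
    fix U x assume U: "openin X U" and xU: "x \<in> U"
    have clU: "closedin X (topspace X - U)" "x \<in> topspace X - (topspace X - U)"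
      using closedin_diff[OF closedin_topspace U] xU openin_subset[OF U] by auto
    obtain V where V: "openin X V" "x \<in> V" "disjnt (topspace X - U) (X closure_of V)"
      using reg[unfolded regular_space] clU by meson
    let ?F = "X closure_of V"
    have FU: "?F \<subseteq> U"
      using V(3) closure_of_subset_topspace[of X V] by (auto simp: disjnt_iff)
    \<comment> \<open>Network elements that some pair of \<open>Q\<close> trims into
      \<open>U\<close> without losing points of \<open>?F\<close>. Fixing a single pair
      \<open>q S\<close> for each of them keeps the final union countable even if \<open>Q\<close>
      is not.\<close>
    define \<M> where "\<M> = {S \<in> \<N>. \<exists>q\<in>Q. S \<inter> ?F \<subseteq> S \<inter> fst q \<and> S \<inter> fst q \<subseteq> U}"
    have "\<forall>S\<in>\<M>. \<exists>q. q \<in> Q \<and> S \<inter> ?F \<subseteq> S \<inter> fst q \<and> S \<inter> fst q \<subseteq> U"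
      unfolding \<M>_def Bex_def by blast
    then obtain q where q: "\<And>S. S \<in> \<M> \<Longrightarrow> q S \<in> Q \<and> S \<inter> ?F \<subseteq> S \<inter> fst (q S) \<and> S \<inter> fst (q S) \<subseteq> U"
      by metis
    have \<M>_cover: "\<exists>S\<in>\<M>. y \<in> S" if y: "y \<in> ?F" for y
    proof -
      have "y \<in> topspace X" using y closure_of_subset_topspace[of X V] by blast
      then obtain C where C: "compactin X C" "y \<in> C"
        "\<And>U. openin X U \<Longrightarrow> C \<subseteq> U \<Longrightarrow> \<exists>S\<in>\<N>. y \<in> S \<and> S \<subseteq> U"
        using compact_networkE[OF \<N>(2)] by metis
      have CX: "C \<subseteq> topspace X" by (rule compactin_subset_topspace[OF C(1)])
      \<comment> \<open>These compact sets are disjoint because \<open>?F\<close> lies in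
        \<open>U\<close>, so \<open>sep\<close> applies to any two points taken from them.\<close>
      have "compactin X (C \<inter> ?F)" "compactin X (C \<inter> (topspace X - U))"
        using compact_Int_closedin[OF C(1)] clU(1) closedin_closure_of by blast+
      then have "\<exists>p\<in>Q. C \<inter> ?F \<subseteq> fst p \<and> C \<inter> (topspace X - U) \<subseteq> snd p"
        unfolding Q_def
      proof (rule finite_pair_lattice_separates_compact[OF P(1)])
        fix x y assume "x \<in> C \<inter> ?F" "y \<in> C \<inter> (topspace X - U)"
        then show "\<exists>p\<in>P. x \<in> fst p \<and> y \<in> snd p" using FU CX by (intro sep) auto
      qed
      then obtain p where p: "p \<in> Q" "C \<inter> ?F \<subseteq> fst p" "C \<inter> (topspace X - U) \<subseteq> snd p" by metis
      have pop: "openin X (fst p)" "openin X (snd p)" "disjnt (fst p) (snd p)"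
        using QP p(1) by (auto simp: disjoint_open_pairs_def)
      \<comment> \<open>A neighbourhood of \<open>C\<close> encoding two implications: its points in
        \<open>?F\<close> lie in \<open>fst p\<close>, and its points in \<open>fst p\<close> avoid
        \<open>snd p\<close> and so lie in \<open>U\<close>. A network element inside it thus
        belongs to \<open>\<M>\<close>.\<close>
      let ?W = "((topspace X - ?F) \<union> fst p) \<inter> (U \<union> snd p)"
      have "openin X ?W" using pop U by (intro openin_Int openin_Un openin_diff) auto
      moreover have "C \<subseteq> ?W" using p CX by auto
      ultimately obtain S where S: "S \<in> \<N>" "y \<in> S" "S \<subseteq> ?W" using C(3) by metis
      have "S \<inter> ?F \<subseteq> S \<inter> fst p" using S(3) by auto
      moreover have "S \<inter> fst p \<subseteq> U" using S(3) pop(3) by (auto simp: disjnt_iff)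
      ultimately have "S \<in> \<M>" using S(1) p(1) unfolding \<M>_def by (intro CollectI conjI bexI[of _ p])
      then show ?thesis using S(2) by metis
    qed
    let ?E = "(\<lambda>S. S \<inter> fst (q S)) ` \<M>"
    have "countable ?E" using \<N>(1) by (auto simp: \<M>_def)
    moreover have "?E \<subseteq> \<P>"
    proof clarify
      fix S assume S: "S \<in> \<M>"
      then have "(S, q S) \<in> (SIGMA S:\<N>. Q)" using q[OF S] by (auto simp: \<M>_def)
      then show "S \<inter> fst (q S) \<in> \<P>" unfolding \<P>_def f_def by (rule rev_image_eqI) simp
    qed
    ultimately have "X interior_of \<Union>?E \<in> \<B>" unfolding \<B>_def by simp
    moreover have "V \<subseteq> X interior_of \<Union>?E"
    proof (rule interior_of_maximal[OF _ V(1)])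
      show "V \<subseteq> \<Union>?E"
      proof
        fix y assume "y \<in> V"
        then have y: "y \<in> ?F" using closure_of_subset[OF openin_subset[OF V(1)]] by blast
        then obtain S where S: "S \<in> \<M>" "y \<in> S" using \<M>_cover by metis
        then have "y \<in> S \<inter> fst (q S)" using q[OF S(1)] y by blast
        then show "y \<in> \<Union>?E" using S(1) by blast
      qed
    qed
    moreover have "X interior_of \<Union>?E \<subseteq> U"
    proof -
      have "\<Union>?E \<subseteq> U" using q by (auto simp: subset_iff)
      then show ?thesis using interior_of_subset[of X "\<Union>?E"] by blast
    qed
    ultimately show "\<exists>B\<in>\<B>. x \<in> B \<and> B \<subseteq> U"
      using V(2) by (intro bexI[of _ "X interior_of \<Union>?E"]) auto
  qed
  ultimately show ?thesis by (auto simp: weight_le_def)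
qed

section \<open>Separating pairs in a Lindelof group\<close>

text \<open>For \<open>x \<noteq> y\<close> some \<open>U\<close> of the pseudobase misses
  \<open>inv x * y\<close>. If \<open>x\<close> lies in a translate of the corresponding
  \<open>V\<close>, then \<open>y\<close> is outside the closure of that translate. By the Lindelof
  property countably many translates per \<open>U\<close> cover the group, which keeps the number of
  pairs within \<open>|K|\<close>.\<close>

lemma topological_group_separating_pairs:
  fixes K :: "'k set"
  assumes tg: "topological_group H T" and L: "Lindelof_space T"
    and \<psi>: "pseudochar_le T K" and K: "infinite K"
  obtains P where "P \<subseteq> disjoint_open_pairs T" "|P| \<le>o |K|"
    "\<And>x y. \<lbrakk>x \<in> topspace T; y \<in> topspace T; x \<noteq> y\<rbrakk> \<Longrightarrow> \<exists>p\<in>P. x \<in> fst p \<and> y \<in> snd p"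
proof -
  have ts: "topspace T = carrier H" using tg by (auto simp: topological_group_def)
  interpret group H using tg by (auto simp: topological_group_def)
  define tr where "tr d V = {z \<in> carrier H. inv\<^bsub>H\<^esub> d \<otimes>\<^bsub>H\<^esub> z \<in> V}" for d V
  obtain \<U> where \<U>: "\<And>U. U \<in> \<U> \<Longrightarrow> openin T U \<and> \<one>\<^bsub>H\<^esub> \<in> U"
      "topspace T \<inter> \<Inter>\<U> = {\<one>\<^bsub>H\<^esub>}" "|\<U>| \<le>o |K|"
    using bspec[OF \<psi>[unfolded pseudochar_le_def], of "\<one>\<^bsub>H\<^esub>"] ts by auto
  \<comment> \<open>All requirements on \<open>V\<close> and its countable set \<open>D\<close> of
    centres are bundled so that both can be chosen simultaneously for every
    \<open>U\<close>.\<close>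
  define good where "good U V D \<longleftrightarrow> openin T V \<and> countable D \<and> D \<subseteq> carrier H \<and>
      (\<forall>x\<in>carrier H. \<exists>d\<in>D. x \<in> tr d V) \<and>
      (\<forall>d\<in>D. \<forall>x\<in>tr d V. \<forall>y\<in>T closure_of (tr d V). inv\<^bsub>H\<^esub> x \<otimes>\<^bsub>H\<^esub> y \<in> U)" for U V D
  have "\<exists>V D. good U V D" if "U \<in> \<U>" for U
  proof -
    have "openin T U" "\<one>\<^bsub>H\<^esub> \<in> U" using \<U>(1)[OF that] by auto
    then obtain V where V: "openin T V" "\<one>\<^bsub>H\<^esub> \<in> V"
      "\<And>d x y. \<lbrakk>d \<in> carrier H; x \<in> carrier H; inv\<^bsub>H\<^esub> d \<otimes>\<^bsub>H\<^esub> x \<in> V;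
         y \<in> T closure_of {z \<in> carrier H. inv\<^bsub>H\<^esub> d \<otimes>\<^bsub>H\<^esub> z \<in> V}\<rbrakk> \<Longrightarrow> inv\<^bsub>H\<^esub> x \<otimes>\<^bsub>H\<^esub> y \<in> U"
      by (rule closure_of_translate[OF tg]) blast
    have op: "\<And>W. W \<in> (\<lambda>d. tr d V) ` carrier H \<Longrightarrow> openin T W"
      using openin_translate[OF tg V(1)] by (auto simp: tr_def)
    have self: "d \<in> tr d V" if "d \<in> carrier H" for d using that V(2) by (simp add: tr_def)
    have cov: "\<Union>((\<lambda>d. tr d V) ` carrier H) = topspace T"
    proof
      show "\<Union>((\<lambda>d. tr d V) ` carrier H) \<subseteq> topspace T" by (auto simp: tr_def ts)
      show "topspace T \<subseteq> \<Union>((\<lambda>d. tr d V) ` carrier H)" using self ts by blast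
    qed
    obtain \<W> where \<W>: "countable \<W>" "\<W> \<subseteq> (\<lambda>d. tr d V) ` carrier H" "\<Union>\<W> = topspace T"
      using Lindelof_spaceD[OF L op cov] by metis
    then obtain D where D: "countable D" "D \<subseteq> carrier H" "\<W> = (\<lambda>d. tr d V) ` D"
      using countable_subset_image by metis
    have "\<exists>d\<in>D. x \<in> tr d V" if "x \<in> carrier H" for x
    proof -
      have "x \<in> \<Union>((\<lambda>d. tr d V) ` D)" using that \<W>(3) D(3) ts by simp
      then show ?thesis by simp
    qed
    moreover have "inv\<^bsub>H\<^esub> x \<otimes>\<^bsub>H\<^esub> y \<in> U"
      if "d \<in> D" "x \<in> tr d V" "y \<in> T closure_of (tr d V)" for d x y
    proof (rule V(3))
      show "y \<in> T closure_of {z \<in> carrier H. inv\<^bsub>H\<^esub> d \<otimes>\<^bsub>H\<^esub> z \<in> V}" using that(3) by (simp add: tr_def)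
    qed (use that D(2) in \<open>auto simp: tr_def\<close>)
    ultimately have "good U V D" using V(1) D(1,2) by (simp add: good_def)
    then show ?thesis by metis
  qed
  then obtain V D where good: "\<And>U. U \<in> \<U> \<Longrightarrow> good U (V U) (D U)" by metis
  \<comment> \<open>Each translate is paired with the complement of its closure.\<close>
  define h where "h = (\<lambda>(U, d). (tr d (V U), topspace T - T closure_of (tr d (V U))))"
  show thesis
  proof
    show "h ` (SIGMA U:\<U>. D U) \<subseteq> disjoint_open_pairs T"
    proof (rule image_subsetI)
      fix p assume "p \<in> (SIGMA U:\<U>. D U)"
      then obtain U d where p: "p = (U, d)" and "U \<in> \<U>" "d \<in> D U" by blast
      then have "openin T (V U)" "d \<in> carrier H" using good[of U] by (auto simp: good_def)
      then have o: "openin T (tr d (V U))" unfolding tr_def by (rule openin_translate[OF tg])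
      moreover have "openin T (topspace T - T closure_of (tr d (V U)))"
        by (intro openin_diff openin_topspace closedin_closure_of)
      moreover have "disjnt (tr d (V U)) (topspace T - T closure_of (tr d (V U)))"
        using closure_of_subset[OF openin_subset[OF o]] by (auto simp: disjnt_iff)
      ultimately show "h p \<in> disjoint_open_pairs T"
        unfolding p h_def disjoint_open_pairs_def by simp
    qed
    have "|D U| \<le>o |K|" if "U \<in> \<U>" for U
    proof (rule ordLeq_transitive)
      show "|D U| \<le>o |UNIV :: nat set|"
        using good[OF that] by (simp add: good_def flip: countable_card_of_nat)
      show "|UNIV :: nat set| \<le>o |K|" using K by (simp add: infinite_iff_card_of_nat)
    qed
    then show "|h ` (SIGMA U:\<U>. D U)| \<le>o |K|"
      by (rule ordLeq_Sigma_infinite[OF K \<U>(3) _ subset_refl])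
    fix x y assume xy: "x \<in> topspace T" "y \<in> topspace T" "x \<noteq> y"
    then have "inv\<^bsub>H\<^esub> x \<otimes>\<^bsub>H\<^esub> y \<noteq> \<one>\<^bsub>H\<^esub>"
      using ts by (metis inv_closed inv_equality inv_inv)
    moreover have "inv\<^bsub>H\<^esub> x \<otimes>\<^bsub>H\<^esub> y \<in> topspace T" using xy ts by simp
    ultimately obtain U where U: "U \<in> \<U>" "inv\<^bsub>H\<^esub> x \<otimes>\<^bsub>H\<^esub> y \<notin> U" using \<U>(2) by blast
    obtain d where d: "d \<in> D U" "x \<in> tr d (V U)"
      using good[OF U(1)] xy(1) ts unfolding good_def by metis
    then have "y \<notin> T closure_of (tr d (V U))"
      using good[OF U(1)] U(2) unfolding good_def by metis
    then have "x \<in> fst (h (U, d)) \<and> y \<in> snd (h (U, d))" using d(2) xy(2) by (simp add: h_def)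
    moreover have "h (U, d) \<in> h ` (SIGMA U:\<U>. D U)" using U(1) d(1) by blast
    ultimately show "\<exists>p\<in>h ` (SIGMA U:\<U>. D U). x \<in> fst p \<and> y \<in> snd p" by (rule bexI)
  qed
qed

section \<open>Weight of a Lindelof Sigma-group and of a group containing it densely\<close>

lemma weight_le_lindelof_sigma_group:
  fixes K :: "'k set"
  assumes tg: "topological_group H T" and ls: "lindelof_sigma T"
    and \<psi>: "pseudochar_le T K" and K: "infinite K"
  shows "weight_le T (Func (UNIV :: nat set) K)"
proof -
  obtain \<N> where \<N>: "countable \<N>" "compact_network T \<N>"
    using lindelof_sigma_imp_compact_network[OF ls] .
  obtain P where P: "P \<subseteq> disjoint_open_pairs T" "|P| \<le>o |K|"
    "\<And>x y. \<lbrakk>x \<in> topspace T; y \<in> topspace T; x \<noteq> y\<rbrakk> \<Longrightarrow> \<exists>p\<in>P. x \<in> fst p \<and> y \<in> snd p"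
    by (rule topological_group_separating_pairs[OF tg compact_network_imp_Lindelof_space[OF \<N>] \<psi> K]) blast
  show ?thesis
    by (rule weight_le_of_separating_pairs[OF topological_group_imp_regular_space[OF tg] \<N> K P(1)
          ordLeq_transitive[OF P(2) ordLeq_Func_nat] P(3)])
qed

text \<open>Equality of weights is expressed as having the same infinite upper bounds, and
  \<open>Func UNIV K\<close> represents \<open>\<kappa>\<^sup>\<omega>\<close>. For infinite
  \<open>'a\<close> the type of \<open>A\<close> and \<open>K\<close> is large enough: bases and
  pseudobases are subsets of \<open>'a set\<close>, so each of their infinite cardinalities is
  attained by a set of this type.\<close>

theorem theorem3:
  fixes H :: "('a, 'b) monoid_scheme" and T :: "'a topology" and G :: "'a set"
  assumes "topological_group H T" and "Hausdorff_space T"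
    and "subgroup G H" and "T closure_of G = topspace T"
    and "lindelof_sigma (subtopology T G)"
  shows "(\<forall>A :: 'a set set set. infinite A \<longrightarrow>
            (weight_le T A \<longleftrightarrow> weight_le (subtopology T G) A)) \<and>
         (\<forall>K :: 'a set set set. infinite K \<longrightarrow> pseudochar_le (subtopology T G) K \<longrightarrow>
            weight_le (subtopology T G) (Func (UNIV :: nat set) K))"
proof (intro conjI allI impI iffI)
  fix A :: "'a set set set" assume "infinite A"
  then show "weight_le T A" if "weight_le (subtopology T G) A"
    using weight_le_of_dense_subgroup[OF assms(1,3,4) that] by simp
qed (auto intro: weight_le_subtopology
    weight_le_lindelof_sigma_group[OF topological_group_subgroup[OF assms(1,3)] assms(5)])

end
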